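(* For every integer $k$ there exists a locally finite graph $G$ with $\delta(G) \geq k$ all of whose ends $\omega$ have minimum limit degree $\delta^+(\omega) \geq k$, witnessed by a defining sequence $C_0 \supseteq C_1 \supseteq \dots$ such that $G - C_n$ is connected for all $n$, but which has no finite subgraph $H$ with $\delta(H) > 2$.
   Context: An end of $G$ is an equivalence class of rays of $G$, two rays being equivalent if no finite vertex set separates them. For a subgraph $U$ of $G$, $V^+(U)$ denotes the set of vertices of $U$ having a neighbour outside $U$. A region of $G$ is a connected induced subgraph $C$ with $V^+(C)$ finite; with $S := N(C)$ (vertices outside $C$ adjacent to $C$), let $G[S,C] := G[S\cup V^+(C)]$ and $\delta_G^+(C) := \min_{v\in V^+(C)} d_{G[S,C]}(v)$. A sequence $C_0 \supseteq C_1 \supseteq \dots$ of regions is a defining sequence for an end $\omega$ if every $C_n$ contains a ray from $\omega$ and $\bigcap_n C_n = \emptyset$. The minimum limit degree is $\delta^+(\omega) := \sup \lim_{n\to\infty} \delta_G^+(C_n)$ over all defining sequences of $\omega$ for which the limit exists ($\infty$ allowed); "witnessed by" a defining sequence means that for that sequence the limit exists and is $\ge k$. *)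

theory Defs
  imports "HOL-Library.Extended_Real"
begin

record 'a graph =
  vertices :: "'a set"
  edges :: "'a set set"

definition simple_graph :: "'a graph \<Rightarrow> bool" where
  "simple_graph G \<longleftrightarrow> (\<forall>e\<in>edges G. e \<subseteq> vertices G \<and> card e = 2)"

definition adj :: "'a graph \<Rightarrow> 'a \<Rightarrow> 'a \<Rightarrow> bool" where
  "adj G u v \<longleftrightarrow> {u, v} \<in> edges G"

definition subgraph :: "'a graph \<Rightarrow> 'a graph \<Rightarrow> bool" where
  "subgraph H G \<longleftrightarrow> simple_graph H \<and> vertices H \<subseteq> vertices G \<and> edges H \<subseteq> edges G"

definition induced :: "'a graph \<Rightarrow> 'a set \<Rightarrow> 'a graph" where
  "induced G X = \<lparr>vertices = vertices G \<inter> X, edges = {e \<in> edges G. e \<subseteq> X}\<rparr>"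

definition delete :: "'a graph \<Rightarrow> 'a set \<Rightarrow> 'a graph" where
  "delete G X = induced G (vertices G - X)"

definition nbrs :: "'a graph \<Rightarrow> 'a \<Rightarrow> 'a set" where
  "nbrs G v = {u. adj G v u}"

definition deg :: "'a graph \<Rightarrow> 'a \<Rightarrow> enat" where
  "deg G v = (if finite (nbrs G v) then enat (card (nbrs G v)) else \<infinity>)"

(* The infimum over the empty vertex set is \<infinity>, so uses of min_degree should be
   accompanied by a nonemptiness condition. *)
definition min_degree :: "'a graph \<Rightarrow> enat" where
  "min_degree G = (INF v\<in>vertices G. deg G v)"

definition locally_finite :: "'a graph \<Rightarrow> bool" where
  "locally_finite G \<longleftrightarrow> (\<forall>v\<in>vertices G. finite (nbrs G v))"

definition linked :: "'a graph \<Rightarrow> 'a \<Rightarrow> 'a \<Rightarrow> bool" where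
  "linked G u v \<longleftrightarrow> u \<in> vertices G \<and> v \<in> vertices G \<and> (adj G)\<^sup>*\<^sup>* u v"

definition connected_graph :: "'a graph \<Rightarrow> bool" where
  "connected_graph G \<longleftrightarrow>
     vertices G \<noteq> {} \<and> (\<forall>u\<in>vertices G. \<forall>v\<in>vertices G. linked G u v)"

(* A ray is given by the enumeration of its vertices from its starting vertex. *)
definition ray :: "'a graph \<Rightarrow> (nat \<Rightarrow> 'a) \<Rightarrow> bool" where
  "ray G r \<longleftrightarrow> inj r \<and> (\<forall>i. r i \<in> vertices G \<and> adj G (r i) (r (Suc i)))"

(* X separates A from B if every path from A to B, trivial ones included, meets X;
   A and B themselves may meet X. *)
definition separates :: "'a graph \<Rightarrow> 'a set \<Rightarrow> 'a set \<Rightarrow> 'a set \<Rightarrow> bool" where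
  "separates G X A B \<longleftrightarrow> \<not> (\<exists>a\<in>A. \<exists>b\<in>B. linked (delete G X) a b)"

definition ray_equiv :: "'a graph \<Rightarrow> ((nat \<Rightarrow> 'a) \<times> (nat \<Rightarrow> 'a)) set" where
  "ray_equiv G = {(r, s). ray G r \<and> ray G s \<and>
     \<not> (\<exists>X. X \<subseteq> vertices G \<and> finite X \<and> separates G X (range r) (range s))}"

definition ends :: "'a graph \<Rightarrow> (nat \<Rightarrow> 'a) set set" where
  "ends G = {r. ray G r} // ray_equiv G"

(* V^+(U) *)
definition inner_boundary :: "'a graph \<Rightarrow> 'a graph \<Rightarrow> 'a set" where
  "inner_boundary G U = {v \<in> vertices U. \<exists>u \<in> vertices G - vertices U. adj G v u}"

(* N(U) *)
definition outer_boundary :: "'a graph \<Rightarrow> 'a graph \<Rightarrow> 'a set" where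
  "outer_boundary G U = {v \<in> vertices G - vertices U. \<exists>u \<in> vertices U. adj G v u}"

definition region :: "'a graph \<Rightarrow> 'a graph \<Rightarrow> bool" where
  "region G C \<longleftrightarrow> vertices C \<subseteq> vertices G \<and> C = induced G (vertices C) \<and>
     connected_graph C \<and> finite (inner_boundary G C)"

(* G[S,C] with S = N(C) *)
definition boundary_graph :: "'a graph \<Rightarrow> 'a graph \<Rightarrow> 'a graph" where
  "boundary_graph G C = induced G (outer_boundary G C \<union> inner_boundary G C)"

(* \<delta>_G^+(C); the value is \<infinity> if C has no inner boundary, that is, if C is a component of G.
   At most finitely many members of a defining sequence are of this kind. *)
definition boundary_min_degree :: "'a graph \<Rightarrow> 'a graph \<Rightarrow> enat" where
  "boundary_min_degree G C = (INF v\<in>inner_boundary G C. deg (boundary_graph G C) v)"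

definition defining_sequence ::
    "'a graph \<Rightarrow> (nat \<Rightarrow> 'a) set \<Rightarrow> (nat \<Rightarrow> 'a graph) \<Rightarrow> bool" where
  "defining_sequence G \<omega> C \<longleftrightarrow>
     (\<forall>n. region G (C n)) \<and> (\<forall>n. subgraph (C (Suc n)) (C n)) \<and>
     (\<forall>n. \<exists>r\<in>\<omega>. ray (C n) r) \<and> (\<Inter>n. vertices (C n)) = {}"

definition min_limit_degree :: "'a graph \<Rightarrow> (nat \<Rightarrow> 'a) set \<Rightarrow> enat" where
  "min_limit_degree G \<omega> = Sup {l. \<exists>C. defining_sequence G \<omega> C \<and>
     (\<lambda>n. boundary_min_degree G (C n)) \<longlonglongrightarrow> l}"

end

theory Submission
  imports Defs
begin

text \<open>
  Take the \<open>m\<close>-ary tree with \<open>m \<ge> 3\<close>, arrange the children of each vertex in a cycle, and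
  join every vertex not only to its parent but also to the successor (\<open>sib\<close>) of its parent in
  that cycle. Every vertex has at most two neighbours that precede it, so the last vertex of a
  finite subgraph has degree at most 2 there.

  Every ray eventually stays in the subtree of exactly one vertex of each level. For a vertex
  \<open>v\<close> on the branch obtained in this way, the region consisting of the subtree at \<open>v\<close> and of
  \<open>sib v\<close> has inner boundary \<open>{v, sib v}\<close>, and both of these vertices have \<open>m\<close> neighbours
  outside: the children of the predecessor of \<open>v\<close> and those of \<open>sib v\<close>, respectively. The
  complement is connected, since a child of \<open>sib v\<close> is also adjacent to \<open>sib (sib v)\<close>.
\<close>

section \<open>Graphs\<close>

lemma adj_sym: "adj G x y \<Longrightarrow> adj G y x"
  by (simp add: adj_def insert_commute)

lemma adj_induced: "adj (induced G X) x y \<longleftrightarrow> adj G x y \<and> x \<in> X \<and> y \<in> X"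
  by (auto simp: adj_def induced_def)

lemma vertices_induced: "vertices (induced G X) = vertices G \<inter> X"
  by (simp add: induced_def)

lemma linked_refl: "x \<in> vertices G \<Longrightarrow> linked G x x"
  by (simp add: linked_def)

lemma linked_step: "adj G x y \<Longrightarrow> linked G y z \<Longrightarrow> x \<in> vertices G \<Longrightarrow> linked G x z"
  by (auto simp: linked_def intro: converse_rtranclp_into_rtranclp)

lemma linked_sym: "linked G x y \<Longrightarrow> linked G y x"
proof -
  have "symp (adj G)"
    by (auto intro: sympI adj_sym)
  then have "symp (adj G)\<^sup>*\<^sup>*"
    by (rule symp_rtranclp)
  then show "linked G x y \<Longrightarrow> linked G y x"
    by (auto simp: linked_def dest: sympD)
qed

lemma connected_graphI:
  assumes "a \<in> vertices G" and "\<And>x. x \<in> vertices G \<Longrightarrow> linked G x a"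
  shows "connected_graph G"
  unfolding connected_graph_def
proof (intro conjI ballI)
  fix x y assume "x \<in> vertices G" "y \<in> vertices G"
  then have "linked G x a" "linked G a y"
    by (simp_all add: assms(2) linked_sym)
  then show "linked G x y"
    by (auto simp: linked_def)
qed (use assms in blast)

lemma deg_ge:
  assumes "X \<subseteq> nbrs G v"
  shows "enat (card X) \<le> deg G v"
  using assms by (auto simp: deg_def card_mono)

lemma deg_le:
  assumes "nbrs G v \<subseteq> X" "finite X"
  shows "deg G v \<le> enat (card X)"
  using assms by (auto simp: deg_def card_mono finite_subset)

lemma subgraph_induced_mono:
  assumes "simple_graph G" "X \<subseteq> Y"
  shows "subgraph (induced G X) (induced G Y)"
  using assms by (auto simp: subgraph_def simple_graph_def induced_def)

lemma subgraph_trans: "subgraph F G \<Longrightarrow> subgraph G H \<Longrightarrow> subgraph F H"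
  by (auto simp: subgraph_def)

lemma subgraph_vertices: "subgraph F G \<Longrightarrow> vertices F \<subseteq> vertices G"
  by (simp add: subgraph_def)

section \<open>Subsequences of defining sequences, and tails of rays\<close>

lemma defining_sequence_subseq:
  assumes C: "defining_sequence G \<omega> C" and s: "strict_mono s"
  shows "defining_sequence G \<omega> (C \<circ> s)"
proof -
  have step: "subgraph (C (Suc n)) (C n)" for n
    using C by (simp add: defining_sequence_def)
  have mono: "subgraph (C n) (C k)" if "k < n" for k n
    using that by (induction rule: less_Suc_induct) (auto intro: subgraph_trans step)
  have "vertices (C (s n)) \<subseteq> vertices (C n)" for n
    using mono[of n "s n"] seq_suble[OF s, of n] by (cases "s n = n") (auto dest: subgraph_vertices)
  then have "(\<Inter>n. vertices (C (s n))) \<subseteq> (\<Inter>n. vertices (C n))"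
    by blast
  then have "(\<Inter>n. vertices ((C \<circ> s) n)) = {}"
    using C by (simp add: defining_sequence_def)
  moreover have "subgraph (C (s (Suc n))) (C (s n))" for n
    using s by (intro mono) (simp add: strict_mono_Suc_iff)
  ultimately show ?thesis
    using C by (simp add: defining_sequence_def)
qed

text \<open>Degrees lie in the compact space \<^typ>\<open>enat\<close>, so a lower bound on the boundary degrees
  is enough: a subsequence has a limit.\<close>

lemma defining_sequence_convergent:
  assumes C: "defining_sequence G \<omega> C" and d: "\<And>n. d \<le> boundary_min_degree G (C n)"
  obtains s l where "defining_sequence G \<omega> (C \<circ> s)"
    "(\<lambda>n. boundary_min_degree G ((C \<circ> s) n)) \<longlonglongrightarrow> l" "d \<le> l"
proof -
  obtain l s where s: "strict_mono s"
    and l: "((\<lambda>n. boundary_min_degree G (C n)) \<circ> s) \<longlonglongrightarrow> l"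
    using compact_complete_linorder by blast
  have "(\<lambda>n. boundary_min_degree G ((C \<circ> s) n)) \<longlonglongrightarrow> l"
    using l by (simp add: o_def)
  moreover from this have "d \<le> l"
    by (rule LIMSEQ_le_const) (use d in auto)
  ultimately show ?thesis
    using that defining_sequence_subseq[OF C s] by blast
qed

text \<open>A finite set misses some vertex of the infinite tail. That vertex lies on both rays, so
  the trivial path at it already shows that they are not separated.\<close>

lemma ray_equiv_shift:
  assumes r: "ray G r"
  shows "(r, \<lambda>i. r (i + N)) \<in> ray_equiv G"
proof -
  have r': "ray G (\<lambda>i. r (i + N))"
    using r unfolding ray_def inj_def by (metis add_Suc add_right_cancel)
  have "\<not> separates G X (range r) (range (\<lambda>i. r (i + N)))" if "finite X" for X
  proof -
    have "infinite (range (\<lambda>i. r (i + N)))"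
      using r' by (auto simp: ray_def dest: range_inj_infinite)
    then have "\<not> range (\<lambda>i. r (i + N)) \<subseteq> X"
      using that finite_subset by metis
    then obtain i where i: "r (i + N) \<notin> X"
      by auto
    then have "linked (delete G X) (r (i + N)) (r (i + N))"
      using r by (intro linked_refl) (auto simp: delete_def induced_def ray_def)
    then show ?thesis
      by (auto simp: separates_def)
  qed
  then show ?thesis
    using r r' by (auto simp: ray_equiv_def)
qed

section \<open>The \<open>m\<close>-ary tree with aunts\<close>

context
  fixes m :: nat
begin

text \<open>The tree is numbered like a heap: the root is 0, and the children of \<open>x\<close> are
  \<open>m * x + 1, \<dots>, m * x + m\<close>. The values \<open>parent 0 = 0\<close> and \<open>sib 0\<close> have no meaning.\<close>

definition parent :: "nat \<Rightarrow> nat" where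
  "parent x = (x - 1) div m"

text \<open>Among the children of a vertex only the last one is a multiple of \<open>m\<close>;
  there the cycle wraps around to the first child.\<close>

definition sib :: "nat \<Rightarrow> nat" where
  "sib x = (if m dvd x then x + 1 - m else x + 1)"

definition children :: "nat \<Rightarrow> nat set" where
  "children x = {y. 0 < y \<and> parent y = x}"

text \<open>Edges directed towards the root. Children of the root get no aunt, since the root has no
  sibling.\<close>

definition up :: "nat \<Rightarrow> nat \<Rightarrow> bool" where
  "up x y \<longleftrightarrow> 0 < x \<and> (y = parent x \<or> 0 < parent x \<and> y = sib (parent x))"

definition aunt_graph :: "nat graph" where
  "aunt_graph = \<lparr>vertices = UNIV, edges = {{x, y} | x y. up x y}\<rparr>"

inductive_set subtree :: "nat \<Rightarrow> nat set" for v where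
  root: "v \<in> subtree v"
| child: "parent y \<in> subtree v \<Longrightarrow> 0 < y \<Longrightarrow> y \<in> subtree v"

text \<open>For positive \<open>v\<close>, the subtree alone would have the children of
  \<open>v\<close> on its inner boundary, with only \<open>v\<close> and \<open>sib v\<close> as
  neighbours in the boundary graph. Adding \<open>sib v\<close>, their common aunt, removes them
  from the boundary.\<close>

definition cone :: "nat \<Rightarrow> nat set" where
  "cone v = insert (sib v) (subtree v)"

context
  assumes m: "3 \<le> m"
begin

section \<open>Arithmetic of the heap numbering\<close>

lemma parent_iff: "0 < x \<Longrightarrow> parent x = q \<longleftrightarrow> m * q < x \<and> x \<le> m * q + m"
proof -
  assume "0 < x"
  have "parent x = q \<longleftrightarrow> q \<le> parent x \<and> parent x < Suc q"
    by auto
  also have "\<dots> \<longleftrightarrow> q * m \<le> x - 1 \<and> x - 1 < Suc q * m"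
    using m by (simp add: parent_def less_eq_div_iff_mult_less_eq div_less_iff_less_mult)
  also have "\<dots> \<longleftrightarrow> m * q < x \<and> x \<le> m * q + m"
    using \<open>0 < x\<close> by (auto simp: mult.commute)
  finally show ?thesis .
qed

lemma children_eq: "children x = {m * x <.. m * x + m}"
proof -
  have "y \<in> children x \<longleftrightarrow> m * x < y \<and> y \<le> m * x + m" for y
    using parent_iff[of y x] by (cases "y = 0") (auto simp: children_def)
  then show ?thesis
    by (intro set_eqI) simp
qed

lemma card_children: "card (children x) = m" and finite_children: "finite (children x)"
  by (simp_all add: children_eq)

lemma parent_less: "0 < x \<Longrightarrow> parent x < x"
  using div_le_dividend[of "x - 1" m] unfolding parent_def by linarith

lemma sib_child:
  assumes "0 < i" "i \<le> m"
  shows "sib (m * q + i) = m * q + (if i = m then 1 else i + 1)"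
proof -
  have "m dvd m * q + i \<longleftrightarrow> i = m"
    using assms by (auto simp: dvd_add_right_iff dest: dvd_imp_le)
  then show ?thesis
    using m by (auto simp: sib_def)
qed

lemma child_cases:
  assumes "0 < x"
  obtains i where "x = m * parent x + i" "0 < i" "i \<le> m"
  using parent_iff[OF assms, of "parent x"] that[of "x - m * parent x"] by auto

lemma parent_child: "0 < i \<Longrightarrow> i \<le> m \<Longrightarrow> parent (m * q + i) = q"
  by (simp add: parent_iff)

text \<open>On the positions \<open>1, ..., m\<close> of the children of one vertex,
  \<open>sib\<close> is a cyclic shift. That its square has no fixed point would fail for a cycle of
  length two.\<close>

lemma sib:
  assumes "0 < x"
  shows sib_pos: "0 < sib x" and parent_sib: "parent (sib x) = parent x"
    and sib_neq: "sib x \<noteq> x" and sib_sib_neq: "sib (sib x) \<noteq> x"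
    and sib_surj: "\<exists>y>0. parent y = parent x \<and> sib y = x \<and> y \<noteq> x"
proof -
  obtain i q where x: "x = m * q + i" and i: "0 < i" "i \<le> m" and q: "q = parent x"
    using child_cases[OF assms] by metis
  show "0 < sib x" "sib x \<noteq> x"
    using i m by (auto simp: x sib_child)
  show "parent (sib x) = parent x"
    using i m by (auto simp: x sib_child parent_child)
  show "sib (sib x) \<noteq> x"
    using i m by (auto simp: x sib_child)
  \<comment> \<open>The cyclic predecessor of position \<open>i\<close>.\<close>
  define j where "j = (if i = 1 then m else i - 1)"
  have j: "0 < j" "j \<le> m" "(if j = m then 1 else j + 1) = i" "j \<noteq> i"
    using i m by (auto simp: j_def)
  then have "sib (m * q + j) = x" "parent (m * q + j) = parent x"
    using q by (simp_all add: x sib_child parent_child del: One_nat_def)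
  moreover have "0 < m * q + j" "m * q + j \<noteq> x"
    using j by (auto simp: x)
  ultimately show "\<exists>y>0. parent y = parent x \<and> sib y = x \<and> y \<noteq> x"
    by blast
qed

lemma up_less:
  assumes "up x y" shows "y < x"
proof -
  have "sib z < x" if "0 < z" "parent x = z" "0 < x" for z
  proof -
    have "sib z \<le> z + m - 1"
      using m by (auto simp: sib_def)
    moreover have "m * z < x"
      using that parent_iff by blast
    \<comment> \<open>This says that \<open>(m - 1) * (z - 1)\<close> is nonnegative.\<close>
    moreover have "z + m \<le> m * z + 1"
      using that m by (cases z; cases m) auto
    ultimately show ?thesis
      using m by linarith
  qed
  then show ?thesis
    using assms by (auto simp: up_def parent_less)
qed

section \<open>Degrees and finite subgraphs\<close>

lemma vertices_aunt_graph [simp]: "vertices aunt_graph = UNIV"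
  by (simp add: aunt_graph_def)

lemma adj_aunt_graph: "adj aunt_graph x y \<longleftrightarrow> up x y \<or> up y x"
  by (auto simp: aunt_graph_def adj_def doubleton_eq_iff)

lemma simple_aunt_graph: "simple_graph aunt_graph"
  by (auto simp: simple_graph_def aunt_graph_def card_insert_if dest: up_less)

lemma adj_parent: "0 < x \<Longrightarrow> adj aunt_graph x (parent x)"
  by (simp add: adj_aunt_graph up_def)

lemma adj_aunt: "0 < x \<Longrightarrow> 0 < parent x \<Longrightarrow> adj aunt_graph x (sib (parent x))"
  by (simp add: adj_aunt_graph up_def)

lemma children_nbrs: "children x \<subseteq> nbrs aunt_graph x"
  by (auto simp: children_def nbrs_def intro: adj_parent adj_sym)

lemma nbrs_less: "{y \<in> nbrs aunt_graph x. y < x} \<subseteq> {parent x, sib (parent x)}"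
proof
  fix y assume "y \<in> {y \<in> nbrs aunt_graph x. y < x}"
  then have "up x y"
    by (auto simp: nbrs_def adj_aunt_graph dest: up_less)
  then show "y \<in> {parent x, sib (parent x)}"
    by (auto simp: up_def)
qed

lemma locally_finite_aunt_graph: "locally_finite aunt_graph"
proof -
  have "finite (nbrs aunt_graph x)" for x
  proof (rule finite_subset)
    \<comment> \<open>A later neighbour of \<open>x\<close> is a child of \<open>x\<close> or of
      some \<open>z\<close> with \<open>sib z = x\<close>. Since \<open>sib\<close> lowers a number
      by less than \<open>m\<close>, the bound \<open>x + m\<close> covers every such
      \<open>z\<close>.\<close>
    show "nbrs aunt_graph x \<subseteq> {parent x, sib (parent x)} \<union> (\<Union>z\<le>x + m. children z)"
    proof
      fix y assume "y \<in> nbrs aunt_graph x"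
      then consider "up x y" | "up y x"
        by (auto simp: nbrs_def adj_aunt_graph)
      then show "y \<in> {parent x, sib (parent x)} \<union> (\<Union>z\<le>x + m. children z)"
      proof cases
        case 2
        then have "parent y \<le> x + m"
          by (auto simp: up_def sib_def split: if_splits)
        then show ?thesis
          using 2 by (auto simp: up_def children_def)
      qed (auto simp: up_def)
    qed
  qed (simp add: finite_children)
  then show ?thesis
    by (simp add: locally_finite_def)
qed

lemma min_degree_aunt_graph: "enat m \<le> min_degree aunt_graph"
  using deg_ge[OF children_nbrs] by (auto simp: min_degree_def card_children intro: INF_greatest)

lemma no_finite_subgraph_min_degree:
  assumes H: "subgraph H aunt_graph" and fin: "finite (vertices H)" and ne: "vertices H \<noteq> {}"
  shows "min_degree H \<le> 2"
proof -
  define x where "x = Max (vertices H)"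
  have x: "x \<in> vertices H"
    using fin ne by (simp add: x_def)
  have "nbrs H x \<subseteq> {y \<in> nbrs aunt_graph x. y < x}"
  proof
    fix y assume y: "y \<in> nbrs H x"
    then have "y \<in> vertices H" "y \<in> nbrs aunt_graph x"
      using H by (auto simp: nbrs_def adj_def subgraph_def simple_graph_def)
    moreover from this have "y \<le> x" "y \<noteq> x"
      using fin by (auto simp: x_def nbrs_def adj_aunt_graph dest: up_less)
    ultimately show "y \<in> {y \<in> nbrs aunt_graph x. y < x}"
      by simp
  qed
  then have "deg H x \<le> enat (card {parent x, sib (parent x)})"
    using nbrs_less by (intro deg_le) auto
  also have "\<dots> \<le> 2"
    using card_insert_le_m1[of 2 "{sib (parent x)}" "parent x"] by (simp add: numeral_eq_enat)
  finally show ?thesis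
    unfolding min_degree_def using x by (meson INF_lower2)
qed

section \<open>Subtrees and cones\<close>

lemma subtree_iff: "y \<in> subtree v \<longleftrightarrow> y = v \<or> 0 < y \<and> parent y \<in> subtree v"
  by (subst subtree.simps) auto

lemma subtree_ge: "y \<in> subtree v \<Longrightarrow> v \<le> y"
proof (induction rule: subtree.induct)
  case (child y)
  then show ?case
    using parent_less[of y] by simp
qed simp

lemma subtree_trans: "x \<in> subtree u \<Longrightarrow> u \<in> subtree v \<Longrightarrow> x \<in> subtree v"
proof (induction rule: subtree.induct)
  case (child y)
  then show ?case
    by (simp add: subtree.child[of y])
qed

lemma subtree_parent: "0 < v \<Longrightarrow> v \<in> subtree (parent v)"
  by (rule subtree.child[OF subtree.root])

lemma subtree_0: "x \<in> subtree 0"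
proof (induction x rule: less_induct)
  case (less x)
  then show ?case
    using parent_less[of x] by (cases "x = 0") (simp_all add: subtree.root subtree.child[of x])
qed

lemma subtree_child:
  assumes "x \<in> subtree v" "x \<noteq> v"
  obtains c where "c \<in> children v" "x \<in> subtree c"
proof -
  have "x = v \<or> (\<exists>c\<in>children v. x \<in> subtree c)"
    using assms(1)
  proof (induction rule: subtree.induct)
    case (child y)
    then show ?case
      by (auto simp: children_def subtree.root subtree.child[of y])
  qed simp
  then show ?thesis
    using assms(2) that by blast
qed

text \<open>Otherwise the common parent would lie in the subtree of \<open>v\<close>, whose elements
  are at least \<open>v\<close> and hence greater than that parent.\<close>

lemma sibling_not_in_subtree:
  assumes "0 < u" "0 < v" "parent u = parent v" "u \<noteq> v"
  shows "u \<notin> subtree v"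
  using assms parent_less[of v] subtree_ge[of "parent v" v] by (auto simp: subtree_iff[of u])

text \<open>This makes the cones along a branch nested.\<close>

lemma cone_subset_subtree_parent:
  assumes "0 < v" shows "cone v \<subseteq> subtree (parent v)"
  using assms subtree_trans[OF _ subtree_parent[OF assms]] subtree_parent[of "sib v"]
  by (auto simp: cone_def parent_sib sib_pos)

lemma cone_pos: "0 < v \<Longrightarrow> x \<in> cone v \<Longrightarrow> 0 < x"
  using subtree_ge[of x v] by (auto simp: cone_def sib_pos)

text \<open>Supplies the outside neighbours on the boundary. The case \<open>u = sib v\<close> is
  included: the cone contains \<open>sib v\<close> but not its children.\<close>

lemma child_of_sibling_not_in_cone:
  assumes u: "0 < u" "parent u = parent v" "u \<noteq> v" and v: "0 < v" and y: "y \<in> children u"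
  shows "y \<notin> cone v"
proof -
  have "parent v \<noteq> u"
    using u parent_less[of u] by auto
  then have "y \<noteq> v" "y \<noteq> sib v"
    using v y by (auto simp: children_def parent_sib)
  then show ?thesis
    using sibling_not_in_subtree[of u v] u v y by (auto simp: cone_def children_def subtree_iff[of y])
qed

text \<open>Siblings below \<open>v\<close> share a parent in the subtree, so aunts and nephews of
  \<open>x\<close> stay in it too. The only exception is the aunt of a child of \<open>v\<close>,
  which is \<open>sib v\<close>.\<close>

lemma adj_leaves_subtree:
  assumes "adj aunt_graph x y" "x \<in> subtree v" "x \<noteq> v"
  shows "y \<in> cone v"
proof -
  have px: "0 < x" "parent x \<in> subtree v"
    using assms by (auto simp: subtree_iff[of x])
  consider "y = parent x" | "0 < parent x" "y = sib (parent x)"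
    | "0 < y" "x = parent y" | "0 < y" "0 < parent y" "x = sib (parent y)"
    using assms(1) by (auto simp: adj_aunt_graph up_def)
  then show ?thesis
  proof cases
    case 1
    then show ?thesis using px by (simp add: cone_def)
  next
    case 2
    show ?thesis
    proof (cases "parent x = v")
      case False
      then have "parent y \<in> subtree v" "0 < y"
        using 2 px subtree_iff[of "parent x" v] by (simp_all add: parent_sib sib_pos)
      then show ?thesis
        by (simp add: cone_def subtree.child[of y])
    qed (simp add: 2 cone_def)
  next
    case 3
    then show ?thesis using assms by (simp add: cone_def subtree.child[of y])
  next
    case 4
    then show ?thesis
      using px by (simp add: cone_def parent_sib subtree.child[of "parent y"] subtree.child[of y])
  qed
qed

text \<open>An edge leaving the subtree of \<open>c\<close> from a vertex other than
  \<open>c\<close> ends in \<open>sib c\<close>, again a child of \<open>v\<close>. Hence crossing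
  between these subtrees uses a child of \<open>v\<close>.\<close>

lemma adj_same_subtree:
  assumes "adj aunt_graph x y" "x \<in> subtree c" "c \<in> children v"
    and "x \<notin> children v" "y \<notin> children v"
  shows "y \<in> subtree c"
proof -
  have "y \<in> cone c"
    using assms by (intro adj_leaves_subtree[of x]) auto
  moreover have "sib c \<in> children v"
    using assms(3) by (auto simp: children_def parent_sib sib_pos)
  ultimately show ?thesis
    using assms(5) by (auto simp: cone_def)
qed

section \<open>Cones as regions: boundary, connectedness and complement\<close>

definition cone_graph :: "nat \<Rightarrow> nat graph" where
  "cone_graph v = induced aunt_graph (cone v)"

lemma vertices_cone_graph [simp]: "vertices (cone_graph v) = cone v"
  by (simp add: cone_graph_def vertices_induced)

lemma inner_boundary_cone: "inner_boundary aunt_graph (cone_graph v) \<subseteq> {v, sib v}"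
  using adj_leaves_subtree by (auto simp: inner_boundary_def cone_def)

text \<open>Parent edges link the subtree to \<open>v\<close>; \<open>sib v\<close> is attached
  through a child of \<open>v\<close>, whose aunt it is.\<close>

lemma connected_cone:
  assumes v: "0 < v"
  shows "connected_graph (cone_graph v)"
proof (rule connected_graphI[where a = v])
  show "v \<in> vertices (cone_graph v)"
    by (simp add: cone_def subtree.root)
  have sub: "linked (cone_graph v) x v" if "x \<in> subtree v" for x
    using that
  proof (induction rule: subtree.induct)
    case root
    then show ?case by (intro linked_refl) (simp add: cone_def subtree.root)
  next
    case (child y)
    then show ?case
      by (intro linked_step[of _ y "parent y"])
        (auto simp: cone_graph_def vertices_induced adj_induced adj_parent cone_def subtree.child[of y])
  qed
  obtain y where y: "0 < y" "parent y = v"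
    using parent_child[of 1 v] m by force
  then have yv: "y \<in> subtree v"
    using subtree_parent by blast
  have "adj (cone_graph v) (sib v) y"
    using adj_aunt[of y] y yv v by (auto simp: cone_graph_def adj_induced cone_def intro: adj_sym)
  then have "linked (cone_graph v) (sib v) v"
    using sub[OF yv] by (rule linked_step) (simp add: cone_def)
  then show "linked (cone_graph v) x v" if "x \<in> vertices (cone_graph v)" for x
    using that sub by (auto simp: cone_def)
qed

text \<open>Each vertex descends to the root through parents. Outside the cone, only a child of
  \<open>sib v\<close> has its parent in the cone, and it takes its aunt instead.\<close>

lemma connected_delete_cone:
  assumes v: "0 < v"
  shows "connected_graph (delete aunt_graph (cone v))"
proof -
  let ?D = "delete aunt_graph (cone v)"
  have vert: "vertices ?D = - cone v"
    by (auto simp: delete_def vertices_induced)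
  have adj: "adj ?D x y \<longleftrightarrow> adj aunt_graph x y \<and> x \<notin> cone v \<and> y \<notin> cone v" for x y
    by (auto simp: delete_def adj_induced)
  have root: "0 \<notin> cone v"
    using cone_pos[OF v, of 0] by auto
  have "linked ?D x 0" if "x \<notin> cone v" for x
    using that
  proof (induction x rule: less_induct)
    case (less x)
    have step: ?case if "up x y" "y \<notin> cone v" for y
      using that less up_less[of x y]
      by (intro linked_step[of _ x y]) (auto simp: vert adj adj_aunt_graph)
    show ?case
    proof (cases "x = 0")
      case True
      then show ?thesis using root by (simp add: linked_refl vert)
    next
      case x: False
      show ?thesis
      proof (cases "parent x \<in> cone v")
        case False
        then show ?thesis using x by (intro step[of "parent x"]) (auto simp: up_def)
      next
        case True
        then have px: "parent x = sib v"
          using less.prems x by (auto simp: cone_def subtree.child[of x])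
        \<comment> \<open>This aunt differs from \<open>v\<close> because the sibling cycle has
          length at least three.\<close>
        have "sib (sib v) \<notin> cone v"
          using v sibling_not_in_subtree[of "sib (sib v)" v]
          by (auto simp: cone_def sib_pos parent_sib sib_neq sib_sib_neq)
        then show ?thesis
          using x v px by (intro step) (auto simp: up_def sib_pos)
      qed
    qed
  qed
  then show ?thesis
    using root by (intro connected_graphI[where a = 0]) (auto simp: vert)
qed

lemma boundary_min_degree_cone:
  assumes v: "0 < v"
  shows "enat m \<le> boundary_min_degree aunt_graph (cone_graph v)"
  unfolding boundary_min_degree_def
proof (rule INF_greatest)
  fix x assume x: "x \<in> inner_boundary aunt_graph (cone_graph v)"
  \<comment> \<open>The children of \<open>u\<close> lie outside the cone and are adjacent to
    \<open>x\<close>, so all \<open>m\<close> of them belong to the outer boundary. Here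
    \<open>u\<close> will be the predecessor of \<open>v\<close> if \<open>x = v\<close>, and
    \<open>sib v\<close> itself if \<open>x = sib v\<close>.\<close>
  have key: "enat m \<le> deg (boundary_graph aunt_graph (cone_graph v)) x"
    if u: "0 < u" "parent u = parent v" "u \<noteq> v" and xu: "children u \<subseteq> nbrs aunt_graph x" for u
  proof -
    have "y \<in> nbrs (boundary_graph aunt_graph (cone_graph v)) x" if y: "y \<in> children u" for y
    proof -
      have "y \<notin> cone v"
        using child_of_sibling_not_in_cone u v y by blast
      moreover have "adj aunt_graph x y"
        using xu y by (auto simp: nbrs_def)
      ultimately show ?thesis
        using x adj_sym[of aunt_graph x y]
        by (auto simp: nbrs_def boundary_graph_def adj_induced outer_boundary_def inner_boundary_def)
    qed
    then show ?thesis
      using deg_ge[of "children u"] by (auto simp: card_children)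
  qed
  obtain u where u: "0 < u" "parent u = parent v" "sib u = v" "u \<noteq> v"
    using sib_surj[OF v] by blast
  consider "x = v" | "x = sib v"
    using x inner_boundary_cone by blast
  then show "enat m \<le> deg (boundary_graph aunt_graph (cone_graph v)) x"
  proof cases
    case 1
    have "children u \<subseteq> nbrs aunt_graph x"
      using adj_aunt u 1 by (auto simp: children_def nbrs_def intro: adj_sym)
    then show ?thesis using key u by blast
  next
    case 2
    then show ?thesis
      using v children_nbrs by (intro key[of "sib v"]) (auto simp: sib_pos parent_sib sib_neq)
  qed
qed

section \<open>The branch of a ray\<close>

text \<open>By injectivity the ray meets \<open>v\<close> and its finitely many children only
  finitely often. From then on it cannot change between the subtrees of these children.\<close>

lemma ray_enters_child:
  assumes r: "ray aunt_graph r" and v: "\<forall>\<^sub>F i in sequentially. r i \<in> subtree v"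
  obtains c where "c \<in> children v" "\<forall>\<^sub>F i in sequentially. r i \<in> subtree c"
proof -
  have "finite (r -` insert v (children v))"
    using r finite_children by (intro finite_vimageI) (auto simp: ray_def)
  then have "\<forall>\<^sub>F i in sequentially. r i \<notin> insert v (children v)"
    by (auto simp: cofinite_eq_sequentially[symmetric] eventually_cofinite vimage_def)
  with v obtain N where N: "\<And>i. N \<le> i \<Longrightarrow> r i \<in> subtree v \<and> r i \<noteq> v \<and> r i \<notin> children v"
    unfolding eventually_sequentially by (metis insertCI le_trans nat_le_linear)
  then obtain c where c: "c \<in> children v" "r N \<in> subtree c"
    using subtree_child by (metis le_refl)
  have "r i \<in> subtree c" if "N \<le> i" for i
    using that
  proof (induction rule: dec_induct)
    case (step i)
    have "adj aunt_graph (r i) (r (Suc i))"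
      using r by (simp add: ray_def)
    then show ?case
      using adj_same_subtree c(1) N step by (meson le_SucI)
  qed (rule c)
  then show ?thesis
    using that c by (auto simp: eventually_sequentially)
qed

lemma ray_branch:
  assumes "ray aunt_graph r"
  obtains b where "\<And>n. b (Suc n) \<in> children (b n)"
    "\<And>n. \<forall>\<^sub>F i in sequentially. r i \<in> subtree (b n)"
proof -
  have "\<exists>b. \<forall>n. (\<forall>\<^sub>F i in sequentially. r i \<in> subtree (b n)) \<and> b (Suc n) \<in> children (b n)"
  proof (rule dependent_nat_choice)
    show "\<exists>v. \<forall>\<^sub>F i in sequentially. r i \<in> subtree v"
      by (intro exI[of _ 0]) (simp add: subtree_0)
  qed (use ray_enters_child[OF assms] in metis)
  then show ?thesis
    using that by blast
qed

lemma end_defining_sequence: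
  assumes "\<omega> \<in> ends aunt_graph"
  obtains b where "\<And>n. 0 < b n" "defining_sequence aunt_graph \<omega> (\<lambda>n. cone_graph (b n))"
proof -
  obtain r where r: "ray aunt_graph r" and \<omega>: "\<omega> = ray_equiv aunt_graph `` {r}"
    using assms by (auto simp: ends_def elim: quotientE)
  obtain b where b: "\<And>n. b (Suc n) \<in> children (b n)"
    and ev: "\<And>n. \<forall>\<^sub>F i in sequentially. r i \<in> subtree (b n)"
    using ray_branch[OF r] by blast
  \<comment> \<open>The sequence starts at \<open>b 1\<close>: \<open>b 0\<close> may be the root,
    for which \<open>sib\<close> has no meaning.\<close>
  have pos: "0 < b (Suc n)" and par: "parent (b (Suc n)) = b n" for n
    using b[of n] by (auto simp: children_def)
  have cone_sub: "cone (b (Suc n)) \<subseteq> subtree (b n)" for n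
    using cone_subset_subtree_parent[OF pos[of n]] par by simp
  \<comment> \<open>Numbers grow along the branch, so the cone at \<open>b (Suc n)\<close> contains
    only vertices from \<open>n\<close> on; this empties the intersection.\<close>
  have "strict_mono b"
    using parent_less[OF pos] par by (simp add: strict_mono_Suc_iff)
  then have "n \<le> x" if "x \<in> cone (b (Suc n))" for n x
    using that cone_sub subtree_ge[of x "b n"] seq_suble[of b n] by fastforce
  then have "x \<notin> cone (b (Suc (Suc x)))" for x
    using not_less_eq_eq by blast
  then have "(\<Inter>n. cone (b (Suc n))) = {}"
    by blast
  moreover have "\<exists>s\<in>\<omega>. ray (cone_graph (b (Suc n))) s" for n
  proof -
    obtain N where "\<And>i. N \<le> i \<Longrightarrow> r i \<in> subtree (b (Suc n))"
      using ev[of "Suc n"] by (auto simp: eventually_sequentially)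
    moreover have "inj (\<lambda>i. r (i + N))"
      using r unfolding ray_def inj_def by (metis add_right_cancel)
    ultimately have "ray (cone_graph (b (Suc n))) (\<lambda>i. r (i + N))"
      using r by (simp add: ray_def cone_graph_def vertices_induced adj_induced cone_def)
    then show ?thesis
      using ray_equiv_shift[OF r] \<omega> by blast
  qed
  moreover have "region aunt_graph (cone_graph (b (Suc n)))" for n
    using connected_cone[OF pos, of n] finite_subset[OF inner_boundary_cone, of "b (Suc n)"]
    by (simp add: region_def cone_graph_def vertices_induced)
  moreover have "cone (b (Suc (Suc n))) \<subseteq> cone (b (Suc n))" for n
    using cone_sub[of "Suc n"] by (auto simp: cone_def)
  then have "subgraph (cone_graph (b (Suc (Suc n)))) (cone_graph (b (Suc n)))" for n
    unfolding cone_graph_def by (intro subgraph_induced_mono simple_aunt_graph)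
  ultimately show ?thesis
    using that[of "\<lambda>n. b (Suc n)"] pos by (simp add: defining_sequence_def)
qed

text \<open>Passing to a subsequence of the cones gives a limit of the boundary degrees; connected
  complements survive, since every cone has one.\<close>

lemma end_witness:
  assumes "\<omega> \<in> ends aunt_graph"
  obtains C l where "defining_sequence aunt_graph \<omega> C"
    "(\<lambda>n. boundary_min_degree aunt_graph (C n)) \<longlonglongrightarrow> l" "enat m \<le> l"
    "\<And>n. connected_graph (delete aunt_graph (vertices (C n)))"
proof -
  obtain b where b: "\<And>n. 0 < b n" "defining_sequence aunt_graph \<omega> (\<lambda>n. cone_graph (b n))"
    using end_defining_sequence[OF assms] by blast
  obtain s l where "defining_sequence aunt_graph \<omega> ((\<lambda>n. cone_graph (b n)) \<circ> s)"
    "(\<lambda>n. boundary_min_degree aunt_graph (((\<lambda>n. cone_graph (b n)) \<circ> s) n)) \<longlonglongrightarrow> l" "enat m \<le> l"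
    using defining_sequence_convergent[OF b(2) boundary_min_degree_cone[OF b(1)]] by blast
  then show ?thesis
    by (rule that) (simp add: connected_delete_cone b)
qed

end

end

theorem theorem3:
  fixes k :: int
  shows "\<exists>G :: nat graph.
    simple_graph G \<and> vertices G \<noteq> {} \<and> locally_finite G \<and>
    min_degree G \<ge> enat (nat k) \<and>
    (\<forall>\<omega>\<in>ends G.
       min_limit_degree G \<omega> \<ge> enat (nat k) \<and>
       (\<exists>C l. defining_sequence G \<omega> C \<and>
          (\<lambda>n. boundary_min_degree G (C n)) \<longlonglongrightarrow> l \<and> l \<ge> enat (nat k) \<and>
          (\<forall>n. connected_graph (delete G (vertices (C n)))))) \<and>
    \<not> (\<exists>H. subgraph H G \<and> finite (vertices H) \<and> vertices H \<noteq> {} \<and> min_degree H > 2)"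
proof -
  \<comment> \<open>The summand 3 guarantees a long enough sibling cycle for every \<open>k\<close>,
    negative ones included.\<close>
  define m where "m = nat k + 3"
  have m: "3 \<le> m" and km: "enat (nat k) \<le> enat m"
    by (simp_all add: m_def)
  show ?thesis
  proof (intro exI[of _ "aunt_graph m"] conjI ballI)
    fix \<omega> assume "\<omega> \<in> ends (aunt_graph m)"
    then obtain C l where C: "defining_sequence (aunt_graph m) \<omega> C"
        "(\<lambda>n. boundary_min_degree (aunt_graph m) (C n)) \<longlonglongrightarrow> l"
        "\<And>n. connected_graph (delete (aunt_graph m) (vertices (C n)))"
      and l: "enat (nat k) \<le> l"
      using end_witness[OF m] km order_trans by metis
    then have "l \<le> min_limit_degree (aunt_graph m) \<omega>"
      unfolding min_limit_degree_def by (intro Sup_upper) blast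
    with l show "enat (nat k) \<le> min_limit_degree (aunt_graph m) \<omega>"
      by (rule order_trans)
    show "\<exists>C l. defining_sequence (aunt_graph m) \<omega> C \<and>
          (\<lambda>n. boundary_min_degree (aunt_graph m) (C n)) \<longlonglongrightarrow> l \<and> l \<ge> enat (nat k) \<and>
          (\<forall>n. connected_graph (delete (aunt_graph m) (vertices (C n))))"
      using C l by blast
  next
    show "enat (nat k) \<le> min_degree (aunt_graph m)"
      using km min_degree_aunt_graph[OF m] by (rule order_trans)
    show "\<not> (\<exists>H. subgraph H (aunt_graph m) \<and> finite (vertices H) \<and> vertices H \<noteq> {} \<and>
        min_degree H > 2)"
      using no_finite_subgraph_min_degree[OF m] by (auto simp: not_less)
  qed (use m in \<open>simp_all add: simple_aunt_graph locally_finite_aunt_graph\<close>)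
qed

end
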